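(* Assume the following. (i) $\mathcal U\subset\mathbb R^m$ is nonempty, closed, and convex (possibly unbounded), and the running cost has the form $\ell(t,z,u)=\ell_0(t,z)+\tfrac12u^\top R(t)u$, where $\ell_0(t,\cdot)$ is continuous in $z$ and $R(t)\in\mathbb R^{m\times m}$ satisfies $R(t)\succeq r_{\min}I$ for some $r_{\min}>0$ and all $t\in[0,T]$. (ii) For almost every $t$ and all relevant tuples $(\hat x,\hat\lambda)\in\hat{\mathcal D}_t$ and $(x,\hat x,\lambda)\in\mathcal D_t$, the maps $u\mapsto\lambda^\top f(t,x,u)$ and $u\mapsto\hat\lambda^\top\hat f(t,\hat x,u)$ are convex on $\mathcal U$ and satisfy a linear growth bound: there exist locally bounded functions $c_f(t,x),c_{\hat f}(t,\hat x)\ge0$ such that for all $u\in\mathcal U$, $$|\lambda^\top f(t,x,u)|\le c_f(t,x)(1+\|u\|),\qquad |\hat\lambda^\top\hat f(t,\hat x,u)|\le c_{\hat f}(t,\hat x)(1+\|u\|).$$ Let $(\hat x^*(\cdot),\hat\lambda^*(\cdot),u^*(\cdot))$ satisfy the PMP conditions for the plant problem P1, and let $(x^\circ(\cdot),\lambda^\circ(\cdot),u^\circ(\cdot))$ satisfy the PMP conditions for the model-based penalized problem P2. Suppose that, for almost every $t\in[0,T]$, $$\nabla_u\ell(t,\hat x^*(t),u)+\nabla_u\big(\hat\lambda^{*\top}(t)\hat f(t,\hat x^*(t),u)\big)=\nabla_u\ell(t,x^\circ(t),u)+\nabla_u\big(\lambda^{\circ\top}(t)f(t,x^\circ(t),u)\big)\quad\text{at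 }u=u^\circ(t),\qquad(\mathrm M)$$ and that the state alignment $$x^\circ(t)=\hat x^*(t)\quad\text{for a.e. }t\in[0,T]$$ holds. Then $$u^\circ(t)=u^*(t)\quad\text{for a.e. }t\in[0,T].$$ Moreover, given the state alignment, a sufficient set of conditions implying $(\mathrm M)$ for a.e. $t$ is: $$\nabla_u\hat f(t,\hat x^*(t),u)=\nabla_uf(t,\hat x^*(t),u)\ \text{ for all }u\in\mathcal U\text{ and a.e. }t,\qquad \lambda^\circ(t)=\hat\lambda^*(t)\ \text{ for a.e. }t.$$
   Context: Let $n,m\in\mathbb N$, $T>0$, $x_0\in\mathbb R^n$. Plant dynamics: $\dot{\hat x}=\hat f(t,\hat x,u)$, $\hat x(0)=x_0$; model dynamics: $\dot x=f(t,x,u)$, $x(0)=x_0$, with $f,\hat f:[0,T]\times\mathbb R^n\times\mathbb R^m\to\mathbb R^n$. Admissible controls are measurable functions $u:[0,T]\to\mathcal U$. $\ell:[0,T]\times\mathbb R^n\times\mathbb R^m\to\mathbb R$ is the running cost, $\phi:\mathbb R^n\to\mathbb R$ the terminal cost, $\beta:[0,T]\to[0,\infty)$ a weighting function. Standing regularity (as required for Pontryagin's Minimum Principle, PMP): $\ell,f,\hat f,\phi$ are differentiable in the state variable, and $\ell,f,\hat f$ are differentiable in $u$. $R(t)\succeq r_{\min}I$ means $R(t)$ is symmetric and $R(t)-r_{\min}I$ is positive semidefinite. Problem P1: minimize $\int_0^T\ell(t,\hat x,u)\,dt+\phi(\hat x(T))$ over admissible $u$, subject to the plant dynamics. Problem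 P2: minimize $\int_0^T\big(\ell(t,x,u)+\beta(t)\|x-\hat x(t)\|^2\big)dt+\phi(x(T))$ over admissible $u$, subject to the model dynamics, where $\hat x(\cdot)$ is the observed plant trajectory, treated as a given exogenous signal. Hamiltonians: $$\hat H(t,\hat x,u,\hat\lambda)=\ell(t,\hat x,u)+\hat\lambda^\top\hat f(t,\hat x,u),\qquad H(t,x,\hat x,u,\lambda)=\ell(t,x,u)+\beta(t)\|x-\hat x\|^2+\lambda^\top f(t,x,u).$$ PMP conditions for P1: $\hat x^*,\hat\lambda^*$ are absolutely continuous, $u^*$ is admissible, $\hat x^*(0)=x_0$, and for a.e. $t\in[0,T]$: $\dot{\hat x}^*=\hat f(t,\hat x^*,u^* )$; $\dot{\hat\lambda}^*=-\nabla_{\hat x}\ell(t,\hat x^*,u^* )-(\nabla_{\hat x}\hat f(t,\hat x^*,u^* ))^\top\hat\lambda^*$, with $\hat\lambda^*(T)=\nabla\phi(\hat x^*(T))$; and $u^*(t)\in\arg\min_{u\in\mathcal U}\hat H(t,\hat x^*(t),u,\hat\lambda^*(t))$. PMP conditions for P2: $x^\circ,\lambda^\circ$ are absolutely continuous, $u^\circ$ is admissible, $x^\circ(0)=x_0$, and for a.e. $t\in[0,T]$: $\dot x^\circ=f(t,x^\circ,u^\circ)$; $\dot\lambda^\circ=-\nabla_x\ell(t,x^\circ,u^\circ)-2\beta(t)(x^\circ-\hat x(t))-(\nabla_xf(t,x^\circ,u^\circ))^\top\lambda^\circ$, with $\lambda^\circ(T)=\nabla\phi(x^\circ(T))$; and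 $u^\circ(t)\in\arg\min_{u\in\mathcal U}H(t,x^\circ(t),\hat x(t),u,\lambda^\circ(t))$. For each $t$, $\hat{\mathcal D}_t\subset\mathbb R^n\times\mathbb R^n$ and $\mathcal D_t\subset\mathbb R^n\times\mathbb R^n\times\mathbb R^n$ are the sets of "relevant" tuples $(\hat x,\hat\lambda)$ and $(x,\hat x,\lambda)$; they contain $(\hat x^*(t),\hat\lambda^*(t))$ and $(x^\circ(t),\hat x(t),\lambda^\circ(t))$, respectively. *)

theory Defs
  imports "HOL-Analysis.Analysis"
begin

definition gradient :: "('a::real_inner \<Rightarrow> real) \<Rightarrow> 'a \<Rightarrow> 'a" where
  "gradient g x = (THE D. GDERIV g x :> D)"

text \<open>The members of \<open>P\<close> are finitely many nonempty compact intervals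
  with pairwise disjoint interiors.\<close>

definition absolutely_continuous_on_real ::
    "real set \<Rightarrow> (real \<Rightarrow> 'a::real_normed_vector) \<Rightarrow> bool" where
  "absolutely_continuous_on_real S g \<longleftrightarrow>
     (\<forall>e>0. \<exists>d>0. \<forall>P. P division_of \<Union>P \<and> \<Union>P \<subseteq> S \<and> (\<Sum>K\<in>P. Sup K - Inf K) < d
        \<longrightarrow> (\<Sum>K\<in>P. norm (g (Sup K) - g (Inf K))) < e)"

definition locally_bounded_on ::
    "'a::topological_space set \<Rightarrow> ('a \<Rightarrow> 'b::metric_space) \<Rightarrow> bool" where
  "locally_bounded_on S g \<longleftrightarrow> (\<forall>p\<in>S. \<exists>V. open V \<and> p \<in> V \<and> bounded (g ` (V \<inter> S)))"

definition pos_semidef :: "real^'m^'m \<Rightarrow> bool" where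
  "pos_semidef A \<longleftrightarrow> transpose A = A \<and> (\<forall>v. 0 \<le> v \<bullet> (A *v v))"

definition admissible :: "real \<Rightarrow> (real^'m) set \<Rightarrow> (real \<Rightarrow> real^'m) \<Rightarrow> bool" where
  "admissible T U u \<longleftrightarrow>
     u \<in> borel_measurable (lebesgue_on {0..T}) \<and> (\<forall>t\<in>{0..T}. u t \<in> U)"

definition plant_hamiltonian ::
    "(real \<Rightarrow> real^'n \<Rightarrow> real^'m \<Rightarrow> real) \<Rightarrow> (real \<Rightarrow> real^'n \<Rightarrow> real^'m \<Rightarrow> real^'n) \<Rightarrow>
     real \<Rightarrow> real^'n \<Rightarrow> real^'m \<Rightarrow> real^'n \<Rightarrow> real" where
  "plant_hamiltonian l fhat t x u lam = l t x u + lam \<bullet> fhat t x u"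

definition model_hamiltonian ::
    "(real \<Rightarrow> real^'n \<Rightarrow> real^'m \<Rightarrow> real) \<Rightarrow> (real \<Rightarrow> real) \<Rightarrow>
     (real \<Rightarrow> real^'n \<Rightarrow> real^'m \<Rightarrow> real^'n) \<Rightarrow>
     real \<Rightarrow> real^'n \<Rightarrow> real^'n \<Rightarrow> real^'m \<Rightarrow> real^'n \<Rightarrow> real" where
  "model_hamiltonian l \<beta> f t x xhat u lam =
     l t x u + \<beta> t * (norm (x - xhat))\<^sup>2 + lam \<bullet> f t x u"

definition pmp_plant ::
    "real \<Rightarrow> real^'n \<Rightarrow> (real^'m) set \<Rightarrow> (real \<Rightarrow> real^'n \<Rightarrow> real^'m \<Rightarrow> real) \<Rightarrow>
     (real \<Rightarrow> real^'n \<Rightarrow> real^'m \<Rightarrow> real^'n) \<Rightarrow> (real^'n \<Rightarrow> real) \<Rightarrow>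
     (real \<Rightarrow> real^'n) \<Rightarrow> (real \<Rightarrow> real^'n) \<Rightarrow> (real \<Rightarrow> real^'m) \<Rightarrow> bool" where
  "pmp_plant T x0 U l fhat \<phi> x lam u \<longleftrightarrow>
     absolutely_continuous_on_real {0..T} x \<and>
     absolutely_continuous_on_real {0..T} lam \<and>
     admissible T U u \<and>
     x 0 = x0 \<and>
     lam T = gradient \<phi> (x T) \<and>
     (AE t in lebesgue_on {0..T}.
        (x has_vector_derivative fhat t (x t) (u t)) (at t within {0..T}) \<and>
        (lam has_vector_derivative
           (- gradient (\<lambda>z. l t z (u t)) (x t)
            - transpose (jacobian (\<lambda>z. fhat t z (u t)) (at (x t))) *v lam t))
          (at t within {0..T}) \<and>
        is_arg_min (\<lambda>v. plant_hamiltonian l fhat t (x t) v (lam t)) (\<lambda>v. v \<in> U) (u t))"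

text \<open>The signal \<open>xhat\<close> is exogenous: it is an arbitrary function of time here and is
  not differentiated.\<close>

definition pmp_model ::
    "real \<Rightarrow> real^'n \<Rightarrow> (real^'m) set \<Rightarrow> (real \<Rightarrow> real^'n \<Rightarrow> real^'m \<Rightarrow> real) \<Rightarrow>
     (real \<Rightarrow> real) \<Rightarrow> (real \<Rightarrow> real^'n \<Rightarrow> real^'m \<Rightarrow> real^'n) \<Rightarrow> (real^'n \<Rightarrow> real) \<Rightarrow>
     (real \<Rightarrow> real^'n) \<Rightarrow>
     (real \<Rightarrow> real^'n) \<Rightarrow> (real \<Rightarrow> real^'n) \<Rightarrow> (real \<Rightarrow> real^'m) \<Rightarrow> bool" where
  "pmp_model T x0 U l \<beta> f \<phi> xhat x lam u \<longleftrightarrow>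
     absolutely_continuous_on_real {0..T} x \<and>
     absolutely_continuous_on_real {0..T} lam \<and>
     admissible T U u \<and>
     x 0 = x0 \<and>
     lam T = gradient \<phi> (x T) \<and>
     (AE t in lebesgue_on {0..T}.
        (x has_vector_derivative f t (x t) (u t)) (at t within {0..T}) \<and>
        (lam has_vector_derivative
           (- gradient (\<lambda>z. l t z (u t)) (x t)
            - (2 * \<beta> t) *\<^sub>R (x t - xhat t)
            - transpose (jacobian (\<lambda>z. f t z (u t)) (at (x t))) *v lam t))
          (at t within {0..T}) \<and>
        is_arg_min (\<lambda>v. model_hamiltonian l \<beta> f t (x t) (xhat t) v (lam t))
          (\<lambda>v. v \<in> U) (u t))"

definition gradient_matching ::
    "real \<Rightarrow> (real \<Rightarrow> real^'n \<Rightarrow> real^'m \<Rightarrow> real) \<Rightarrow>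
     (real \<Rightarrow> real^'n \<Rightarrow> real^'m \<Rightarrow> real^'n) \<Rightarrow> (real \<Rightarrow> real^'n \<Rightarrow> real^'m \<Rightarrow> real^'n) \<Rightarrow>
     (real \<Rightarrow> real^'n) \<Rightarrow> (real \<Rightarrow> real^'n) \<Rightarrow>
     (real \<Rightarrow> real^'n) \<Rightarrow> (real \<Rightarrow> real^'n) \<Rightarrow> (real \<Rightarrow> real^'m) \<Rightarrow> bool" where
  "gradient_matching T l fhat f xs lams xo lamo uo \<longleftrightarrow>
     (AE t in lebesgue_on {0..T}.
        gradient (\<lambda>u. l t (xs t) u) (uo t) + gradient (\<lambda>u. lams t \<bullet> fhat t (xs t) u) (uo t)
        = gradient (\<lambda>u. l t (xo t) u) (uo t) + gradient (\<lambda>u. lamo t \<bullet> f t (xo t) u) (uo t))"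

lemma gradient_eqI:
  assumes "GDERIV g x :> D"
  shows "gradient g x = D"
  unfolding gradient_def
proof (rule the_equality)
  fix D' assume "GDERIV g x :> D'"
  with assms have "(\<lambda>h. h \<bullet> D') = (\<lambda>h. h \<bullet> D)"
    unfolding gderiv_def by (rule has_derivative_unique[rotated])
  then have "h \<bullet> D' = h \<bullet> D" for h
    by (rule fun_cong)
  then show "D' = D"
    using vector_eq_ldot by blast
qed (fact assms)

lemma gderiv_gradient:
  fixes g :: "'a::euclidean_space \<Rightarrow> real"
  assumes "g differentiable (at x)"
  shows "GDERIV g x :> gradient g x"
proof -
  from assms obtain g' where g': "(g has_derivative g') (at x)"
    unfolding differentiable_def by blast
  have "g' = (\<lambda>h. h \<bullet> adjoint g' 1)"
    by (rule ext) (simp add: adjoint_works[OF has_derivative_linear[OF g']])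
  then have "GDERIV g x :> adjoint g' 1"
    unfolding gderiv_def using g' by (rule subst[where P = "\<lambda>k. (g has_derivative k) (at x)"])
  then show ?thesis
    by (simp only: gradient_eqI)
qed

end

theory Submission
  imports Defs
begin

text \<open>At almost every time, stationarity of \<open>uo\<close> for the model Hamiltonian transfers through
  the matched gradients to the variational inequality \<open>0 \<le> (v - uo) \<bullet> \<nabla>Hhat(uo)\<close> on \<open>U\<close> for
  the plant Hamiltonian at the same state. The latter is a convex function plus a quadratic
  with modulus \<open>rmin\<close>, so \<open>us\<close>, whose value does not exceed that of \<open>uo\<close>, must equal \<open>uo\<close>.\<close>

text \<open>The limit is taken from the right because the later uses move from \<open>a\<close> into
  a convex set: for small \<open>s > 0\<close> the points \<open>a + s *\<^sub>R d\<close> stay in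
  the set when \<open>d\<close> points to another of its members, whereas negative \<open>s\<close>
  may leave it.\<close>

lemma gderiv_directional:
  assumes "GDERIV g a :> D"
  shows "((\<lambda>s. (g (a + s *\<^sub>R d) - g a) / s) \<longlongrightarrow> d \<bullet> D) (at_right 0)"
proof -
  have "((\<lambda>s. a + s *\<^sub>R d) has_derivative (\<lambda>s. s *\<^sub>R d)) (at (0::real))"
    by (auto intro!: derivative_eq_intros)
  moreover have "(g has_derivative (\<lambda>h. h \<bullet> D)) (at (a + 0 *\<^sub>R d))"
    using assms by (simp add: gderiv_def)
  ultimately have "((\<lambda>s. g (a + s *\<^sub>R d)) has_derivative (\<lambda>s. (s *\<^sub>R d) \<bullet> D)) (at (0::real))"
    by (rule has_derivative_compose)
  then have "((\<lambda>s. g (a + s *\<^sub>R d)) has_real_derivative d \<bullet> D) (at 0 within {0<..})"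
    by (auto simp: has_field_derivative_def mult.commute fun_eq_iff
        intro: has_derivative_at_withinI elim!: has_derivative_eq_rhs)
  then show ?thesis
    by (simp add: has_field_derivative_iff)
qed

text \<open>Convexity keeps the segment from \<open>a\<close> to \<open>b\<close> inside
  \<open>U\<close>, so every difference quotient along it is nonnegative, and so is the limit. As
  \<open>a\<close> may lie on the boundary of \<open>U\<close>, a variational inequality replaces
  \<open>D = 0\<close>.\<close>

lemma gderiv_minimizer_nonneg:
  assumes "GDERIV g a :> D" and "convex U" and "a \<in> U" and "b \<in> U"
    and min: "\<And>v. v \<in> U \<Longrightarrow> g a \<le> g v"
  shows "0 \<le> (b - a) \<bullet> D"
proof (rule tendsto_lowerbound[OF gderiv_directional[OF assms(1)]])
  show "\<forall>\<^sub>F s in at_right 0. 0 \<le> (g (a + s *\<^sub>R (b - a)) - g a) / s"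
    using eventually_at_right_real[of 0 1]
  proof (rule eventually_mono)
    fix s :: real assume s: "s \<in> {0<..<1}"
    have "(1 - s) *\<^sub>R a + s *\<^sub>R b \<in> U"
      using s assms(2-4) by (intro convexD) auto
    then have "a + s *\<^sub>R (b - a) \<in> U"
      by (simp add: algebra_simps)
    then show "0 \<le> (g (a + s *\<^sub>R (b - a)) - g a) / s"
      using s min by simp
  qed simp
qed simp

text \<open>For \<open>0 < s < 1\<close> convexity bounds each difference quotient towards
  \<open>b\<close> by the full increment; the bound survives the limit.\<close>

lemma convex_on_gderiv_le:
  assumes "GDERIV g a :> D" and cvx: "convex_on U g" and "a \<in> U" and "b \<in> U"
  shows "(b - a) \<bullet> D \<le> g b - g a"
proof (rule tendsto_upperbound[OF gderiv_directional[OF assms(1)]])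
  show "\<forall>\<^sub>F s in at_right 0. (g (a + s *\<^sub>R (b - a)) - g a) / s \<le> g b - g a"
    using eventually_at_right_real[of 0 1]
  proof (rule eventually_mono)
    fix s :: real assume s: "s \<in> {0<..<1}"
    have "g ((1 - s) *\<^sub>R a + s *\<^sub>R b) \<le> (1 - s) * g a + s * g b"
      using s assms(3,4) by (intro convex_onD[OF cvx]) auto
    then have "g (a + s *\<^sub>R (b - a)) - g a \<le> (g b - g a) * s"
      by (simp add: algebra_simps)
    then show "(g (a + s *\<^sub>R (b - a)) - g a) / s \<le> g b - g a"
      using s by (simp add: pos_divide_le_eq)
  qed simp
qed simp

lemma gderiv_quadratic_form:
  fixes A :: "real^'m^'m"
  assumes "transpose A = A"
  shows "GDERIV (\<lambda>u. c + 1/2 * (u \<bullet> (A *v u))) a :> A *v a"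
proof -
  \<comment> \<open>By symmetry the two terms of the product rule coincide, which absorbs the factor
    1/2.\<close>
  have "h \<bullet> (A *v a) = a \<bullet> (A *v h)" for h
    using dot_lmul_matrix[of a A h] vector_transpose_matrix[of a A] assms
    by (simp add: inner_commute)
  moreover have "((\<lambda>u. c + 1/2 * (u \<bullet> (A *v u))) has_derivative
      (\<lambda>h. 0 + 1/2 * (a \<bullet> (A *v h) + h \<bullet> (A *v a)))) (at a)"
    by (intro has_derivative_add has_derivative_const has_derivative_mult_right
        has_derivative_inner has_derivative_ident bounded_linear_imp_has_derivative
        matrix_vector_mul_bounded_linear)
  ultimately show ?thesis
    by (simp add: gderiv_def)
qed

text \<open>For symmetric \<open>A\<close> the right side minus
  \<open>(b - a) \<bullet> (A *v a)\<close> is exactly half the quadratic form of \<open>A\<close>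
  at \<open>b - a\<close>, and \<open>pos_semidef (A - mat r)\<close> bounds that form below by
  \<open>r\<close> times the squared norm.\<close>

lemma quadratic_form_expansion:
  fixes A :: "real^'m^'m"
  assumes "transpose A = A" and "pos_semidef (A - mat r)"
  shows "r / 2 * (norm (b - a))\<^sup>2 + (b - a) \<bullet> (A *v a)
         \<le> 1/2 * (b \<bullet> (A *v b)) - 1/2 * (a \<bullet> (A *v a))"
proof -
  have "mat r *v (b - a) = r *\<^sub>R (b - a)"
    by (simp add: vec_eq_iff matrix_vector_mult_def mat_def if_distrib[of "\<lambda>x. x * _"]
        cong: if_cong)
  moreover have "0 \<le> (b - a) \<bullet> ((A - mat r) *v (b - a))"
    using assms(2) unfolding pos_semidef_def by blast
  ultimately have "r * (norm (b - a))\<^sup>2 \<le> (b - a) \<bullet> (A *v (b - a))"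
    by (simp add: matrix_vector_mult_diff_rdistrib inner_diff_right power2_norm_eq_inner)
  moreover have "b \<bullet> (A *v a) = a \<bullet> (A *v b)"
    using dot_lmul_matrix[of a A b] vector_transpose_matrix[of a A] assms(1)
    by (simp add: inner_commute)
  ultimately show ?thesis
    by (simp add: matrix_vector_mult_diff_distrib inner_diff_left inner_diff_right)
qed

text \<open>The transposed Jacobian is the adjoint of the derivative of \<open>F\<close>. The
  gradient thus depends on \<open>F\<close> only through its Jacobian, which is how matching
  Jacobians yield matching gradients.\<close>

lemma gderiv_inner_jacobian:
  fixes F :: "real^'m \<Rightarrow> real^'n"
  assumes "F differentiable (at u)"
  shows "GDERIV (\<lambda>v. p \<bullet> F v) u :> transpose (jacobian F (at u)) *v p"
proof -
  have "(F has_derivative (\<lambda>h. jacobian F (at u) *v h)) (at u)"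
    using assms jacobian_works by blast
  then have "((\<lambda>v. p \<bullet> F v) has_derivative (\<lambda>h. p \<bullet> (jacobian F (at u) *v h))) (at u)"
    by (rule has_derivative_inner_right)
  moreover have "p \<bullet> (jacobian F (at u) *v h) = h \<bullet> (transpose (jacobian F (at u)) *v p)" for h
    using dot_lmul_matrix[of p "jacobian F (at u)" h] by (simp add: inner_commute)
  ultimately show ?thesis
    by (simp add: gderiv_def)
qed

text \<open>This is the situation at one fixed time: \<open>L\<close> is the common running cost,
  \<open>p\<close> and \<open>q\<close> are the costate terms of plant and model, and
  \<open>k\<close> is the tracking penalty, constant in the control.\<close>

lemma arg_min_eq_if_gradients_match:
  fixes A :: "real^'m^'m"
  assumes A: "transpose A = A" "pos_semidef (A - mat r)" "r > 0"
    and L: "\<And>u. L u = c + 1/2 * (u \<bullet> (A *v u))"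
    and "convex U" and cvx: "convex_on U p"
    and diff: "p differentiable (at a)" "q differentiable (at a)"
    and a: "is_arg_min (\<lambda>v. L v + k + q v) (\<lambda>v. v \<in> U) a"
    and b: "is_arg_min (\<lambda>v. L v + p v) (\<lambda>v. v \<in> U) b"
    and match: "gradient L a + gradient p a = gradient L a + gradient q a"
  shows "a = b"
proof -
  have L_gderiv: "GDERIV L a :> A *v a"
    using gderiv_quadratic_form[OF A(1)] by (simp add: L[abs_def])
  \<comment> \<open>The gradient of \<open>L\<close> cancels in \<open>match\<close>, so
    \<open>q\<close> has the gradient of \<open>p\<close> at \<open>a\<close>.\<close>
  have p_gderiv: "GDERIV p a :> gradient p a" and q_gderiv: "GDERIV q a :> gradient p a"
    using gderiv_gradient[OF diff(1)] gderiv_gradient[OF diff(2)] match by auto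
  have U: "a \<in> U" "b \<in> U"
    using a b by (auto simp: is_arg_min_def)
  have "0 \<le> (b - a) \<bullet> (A *v a + gradient p a)"
  proof (rule gderiv_minimizer_nonneg[OF GDERIV_add[OF L_gderiv q_gderiv] \<open>convex U\<close> U])
    fix v assume "v \<in> U"
    then show "L a + q a \<le> L v + q v"
      using a by (auto simp: is_arg_min_linorder)
  qed
  moreover have "(b - a) \<bullet> gradient p a \<le> p b - p a"
    by (rule convex_on_gderiv_le[OF p_gderiv cvx U])
  moreover have "L b + p b \<le> L a + p a"
    using b U by (auto simp: is_arg_min_linorder)
  \<comment> \<open>Adding the lower bounds on the increments of \<open>L\<close> and
    \<open>p\<close> from \<open>a\<close> to \<open>b\<close>, the linear parts combine to the
    nonnegative term above, while the total increment is at most 0 because \<open>b\<close>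
    minimizes \<open>L + p\<close>.\<close>
  ultimately have "r / 2 * (norm (b - a))\<^sup>2 \<le> 0"
    using quadratic_form_expansion[OF A(1,2), of b a] by (simp add: L inner_add_right)
  then show ?thesis
    using \<open>r > 0\<close> by (simp add: mult_le_0_iff)
qed

theorem theorem3:
  fixes T :: real and x0 :: "real^'n" and U :: "(real^'m) set"
    and l :: "real \<Rightarrow> real^'n \<Rightarrow> real^'m \<Rightarrow> real"
    and l0 :: "real \<Rightarrow> real^'n \<Rightarrow> real" and R :: "real \<Rightarrow> real^'m^'m" and rmin :: real
    and f fhat :: "real \<Rightarrow> real^'n \<Rightarrow> real^'m \<Rightarrow> real^'n"
    and \<phi> :: "real^'n \<Rightarrow> real" and \<beta> :: "real \<Rightarrow> real"
    and Dhat :: "real \<Rightarrow> ((real^'n) \<times> (real^'n)) set"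
    and D :: "real \<Rightarrow> ((real^'n) \<times> (real^'n) \<times> (real^'n)) set"
    and xhat xs lams xo lamo :: "real \<Rightarrow> real^'n" and us uo :: "real \<Rightarrow> real^'m"
  assumes "T > 0"
    and beta_nonneg: "\<forall>t\<in>{0..T}. \<beta> t \<ge> 0"
    and diff_state: "\<forall>t\<in>{0..T}. \<forall>x u.
          (\<lambda>z. l t z u) differentiable (at x) \<and>
          (\<lambda>z. f t z u) differentiable (at x) \<and>
          (\<lambda>z. fhat t z u) differentiable (at x)"
    and diff_terminal: "\<forall>x. \<phi> differentiable (at x)"
    and diff_control: "\<forall>t\<in>{0..T}. \<forall>x u.
          (\<lambda>v. l t x v) differentiable (at u) \<and>
          (\<lambda>v. f t x v) differentiable (at u) \<and>
          (\<lambda>v. fhat t x v) differentiable (at u)"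
    and U: "U \<noteq> {}" "closed U" "convex U"
    and cost: "\<forall>t\<in>{0..T}. \<forall>z u. l t z u = l0 t z + 1/2 * (u \<bullet> (R t *v u))"
    and l0_cont: "\<forall>t\<in>{0..T}. continuous_on UNIV (l0 t)"
    and R_bound: "rmin > 0"
          "\<forall>t\<in>{0..T}. transpose (R t) = R t \<and> pos_semidef (R t - mat rmin)"
    and growth: "\<exists>cf chat :: real \<Rightarrow> real^'n \<Rightarrow> real.
          locally_bounded_on ({0..T} \<times> UNIV) (\<lambda>(t, x). cf t x) \<and>
          locally_bounded_on ({0..T} \<times> UNIV) (\<lambda>(t, x). chat t x) \<and>
          (\<forall>t\<in>{0..T}. \<forall>x. cf t x \<ge> 0 \<and> chat t x \<ge> 0) \<and>
          (AE t in lebesgue_on {0..T}.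
             (\<forall>(y, p)\<in>Dhat t.
                convex_on U (\<lambda>u. p \<bullet> fhat t y u) \<and>
                (\<forall>u\<in>U. \<bar>p \<bullet> fhat t y u\<bar> \<le> chat t y * (1 + norm u))) \<and>
             (\<forall>(x, y, p)\<in>D t.
                convex_on U (\<lambda>u. p \<bullet> f t x u) \<and>
                (\<forall>u\<in>U. \<bar>p \<bullet> f t x u\<bar> \<le> cf t x * (1 + norm u))))"
    and Dhat_mem: "\<forall>t\<in>{0..T}. (xs t, lams t) \<in> Dhat t"
    and D_mem: "\<forall>t\<in>{0..T}. (xo t, xhat t, lamo t) \<in> D t"
    and plant: "pmp_plant T x0 U l fhat \<phi> xs lams us"
    and model: "pmp_model T x0 U l \<beta> f \<phi> xhat xo lamo uo"
    and alignment: "AE t in lebesgue_on {0..T}. xo t = xs t"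
  shows "(gradient_matching T l fhat f xs lams xo lamo uo
            \<longrightarrow> (AE t in lebesgue_on {0..T}. uo t = us t)) \<and>
         ((AE t in lebesgue_on {0..T}. \<forall>u\<in>U.
             jacobian (\<lambda>v. fhat t (xs t) v) (at u) = jacobian (\<lambda>v. f t (xs t) v) (at u)) \<and>
          (AE t in lebesgue_on {0..T}. lamo t = lams t)
            \<longrightarrow> gradient_matching T l fhat f xs lams xo lamo uo)"
proof (intro conjI impI; (elim conjE)?)
  \<comment> \<open>Some assumptions hold at every time in the interval, others only almost
    everywhere; with membership as an a.e. fact, all can be used at one common
    \<open>t\<close>.\<close>
  have time: "AE t in lebesgue_on {0..T}. t \<in> {0..T}"
    by (rule AE_I2) simp
  have inner_diff: "(\<lambda>v. p \<bullet> F v) differentiable (at u)"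
    if "F differentiable (at u)" for p and F :: "real^'m \<Rightarrow> real^'n" and u
    using that by (auto simp: differentiable_def intro: has_derivative_inner_right)
  have us: "AE t in lebesgue_on {0..T}. is_arg_min
      (\<lambda>v. l t (xs t) v + lams t \<bullet> fhat t (xs t) v) (\<lambda>v. v \<in> U) (us t)"
    using plant unfolding pmp_plant_def plant_hamiltonian_def by (auto elim: eventually_mono)
  have uo: "AE t in lebesgue_on {0..T}. is_arg_min
      (\<lambda>v. l t (xo t) v + \<beta> t * (norm (xo t - xhat t))\<^sup>2 + lamo t \<bullet> f t (xo t) v)
      (\<lambda>v. v \<in> U) (uo t)"
    using model unfolding pmp_model_def model_hamiltonian_def by (auto elim: eventually_mono)
  have cvx: "AE t in lebesgue_on {0..T}. \<forall>(y, p)\<in>Dhat t. convex_on U (\<lambda>u. p \<bullet> fhat t y u)"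
    using growth by (auto elim!: eventually_mono)
  show "AE t in lebesgue_on {0..T}. uo t = us t"
    if "gradient_matching T l fhat f xs lams xo lamo uo"
    using time us uo cvx alignment that[unfolded gradient_matching_def]
  proof eventually_elim
    case (elim t)
    show ?case
    \<comment> \<open>Alignment places both Hamiltonians at the state \<open>xs t\<close>, so they
      share the running cost, whose control part is the quadratic form of
      \<open>R t\<close>.\<close>
    proof (rule arg_min_eq_if_gradients_match)
      show "transpose (R t) = R t" "pos_semidef (R t - mat rmin)" "rmin > 0"
        using R_bound elim(1) by auto
      show "l t (xs t) u = l0 t (xs t) + 1/2 * (u \<bullet> (R t *v u))" for u
        using cost elim(1) by blast
      show "convex_on U (\<lambda>u. lams t \<bullet> fhat t (xs t) u)"
        using elim(1,4) Dhat_mem by fast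
      show "(\<lambda>u. lams t \<bullet> fhat t (xs t) u) differentiable (at (uo t))"
        "(\<lambda>u. lamo t \<bullet> f t (xs t) u) differentiable (at (uo t))"
        using diff_control elim(1) by (blast intro: inner_diff)+
    qed (use U(3) elim in simp_all)
  qed
  show "gradient_matching T l fhat f xs lams xo lamo uo"
    if "AE t in lebesgue_on {0..T}. \<forall>u\<in>U.
          jacobian (\<lambda>v. fhat t (xs t) v) (at u) = jacobian (\<lambda>v. f t (xs t) v) (at u)"
      and "AE t in lebesgue_on {0..T}. lamo t = lams t"
    unfolding gradient_matching_def
    using time uo alignment that
  proof eventually_elim
    case (elim t)
    \<comment> \<open>The Jacobians agree only on \<open>U\<close>, and the gradients are compared
      at \<open>uo t\<close>, so its membership in \<open>U\<close> is required.\<close>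
    then have "uo t \<in> U"
      by (simp add: is_arg_min_def)
    moreover have "gradient (\<lambda>u. p \<bullet> fhat t x u) v = transpose (jacobian (fhat t x) (at v)) *v p"
      "gradient (\<lambda>u. p \<bullet> f t x u) v = transpose (jacobian (f t x) (at v)) *v p" for p x v
      by (rule gradient_eqI, rule gderiv_inner_jacobian, use diff_control elim(1) in blast)+
    ultimately show ?case
      using elim by simp
  qed
qed

end
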